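(* Let $\mathcal X=\{x\in\mathbb R^n: l_j\le x_j\le u_j,\ j=1,\dots,n\}$ be a box with vertices $\{\tilde x^i\}_{i=1}^{2^n}$, let $\hat f:\mathcal X\to\mathbb R$ denote a trained input convex neural network (ICNN) with parameters $\{W_k,S_k,b_k\}_{k=0}^{K-1}$ over $\mathcal X$, and let $\bar z(\cdot)$ denote its concave envelope over $\mathcal X$. Consider the original problem $$\text{(P)}\qquad \min_{x,y}\ h(x,y)\quad\text{s.t.}\quad g(x,y)\le 0,\quad y=\hat f(x),\quad x\in\mathcal X,$$ and the problem $$\text{(R)}\qquad \min_{x,y,z,\alpha}\ h(x,y)\quad\text{s.t.}\quad g(x,y)\le 0,\quad x\in\mathcal X,\quad\text{and the constraints (C)},$$ where (C) denotes the following system of epigraph and envelope constraints in $x$, $y$, $z=(z_0,\dots,z_K)$ and $\alpha\in\mathbb R^{2^n}$: $$y=z_K,\qquad x=z_0,\qquad z_{k+1}\ge W_kz_k+S_kz_0+b_k\ (k=0,\dots,K-1),\qquad z_k\ge 0\ (k=1,\dots,K-1),$$ $$x=\sum_{i=1}^{2^n}\alpha_i\tilde x^i,\qquad \sum_{i=1}^{2^n}\alpha_i=1,\qquad z_K\le\sum_{i=1}^{2^n}\alpha_i\hat f(\tilde x^i),\qquad \alpha_i\ge 0\ (i=1,\dots,2^n).$$ Define $$\mathcal F=\{(x,y)\in\mathcal X\times\mathbb R:\ \exists\,(z,\alpha)\text{ satisfying (C)}\},$$ the projection onto $(x,y)$ of the feasible set defined by the epigraph and envelope constraints of (R). Then $$\mathcal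 F=\{(x,y): x\in\mathcal X,\ \hat f(x)\le y\le\bar z(x)\}=\operatorname{conv}\bigl(\{(x,\hat f(x)):x\in\mathcal X\}\bigr),$$ that is, $\mathcal F$ is the convex hull of the graph of $\hat f$ over $\mathcal X$. Consequently, (R) is the strongest continuous relaxation of (P) obtainable by relaxing the ICNN constraint $y=\hat f(x)$ alone.
   Context: Input convex neural network (ICNN). Let $K\ge 1$, with layer widths $n_0=n,n_1,\dots,n_{K-1},n_K=1$. Parameters: real matrices $W_k\in\mathbb R^{n_{k+1}\times n_k}$, $S_k\in\mathbb R^{n_{k+1}\times n}$ and vectors $b_k\in\mathbb R^{n_{k+1}}$, $k=0,\dots,K-1$, with $W_0=0$ by convention and all entries of $W_1,\dots,W_{K-1}$ non-negative ($S_k,b_k$ unrestricted in sign). The network uses ReLU activations in the hidden layers and an identity output layer: its output on input $z_0\in\mathbb R^n$ is $\hat f(z_0)=z_K$, where $$z_{k+1}=\max\{0,\,W_kz_k+S_kz_0+b_k\}\ \text{(componentwise)},\ k=0,\dots,K-2,\qquad z_K=W_{K-1}z_{K-1}+S_{K-1}z_0+b_{K-1}.$$ In the system (C), $z_k\in\mathbb R^{n_k}$ are auxiliary variables (not necessarily the forward-pass values), and inequalities between vectors are componentwise. Optimisation problem. $h$ and $g$ are the objective function and the constraint function of an optimisation model in the decision variables $(x,y)$ in which the trained network is embedded. Vertices. The points $\tilde x^1,\dots,\tilde x^{2^n}$ are those obtained from all $2^n$ combinations of choosing, for each coordinate $j$, either $l_j$ or $u_j$. Concave envelope. $\bar z(\cdot)$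 is the pointwise smallest concave function on $\mathcal X$ that is $\ge\hat f$ on $\mathcal X$; it is characterised as the value function of a linear program, $$\bar z(x)=\max\Bigl\{\sum_{i=1}^{2^n}\alpha_i\hat f(\tilde x^i):\ \sum_{i=1}^{2^n}\alpha_i\tilde x^i=x,\ \sum_{i=1}^{2^n}\alpha_i=1,\ \alpha_i\ge 0\ (i=1,\dots,2^n)\Bigr\},\quad x\in\mathcal X.$$ $\operatorname{conv}$ denotes the convex hull. *)

theory Defs
  imports "HOL-Analysis.Analysis" "Jordan_Normal_Form.Matrix"
begin

text \<open>
  Layer widths vary with the layer index, so the vectors and matrices inside the network are those of
  \<^theory>\<open>Jordan_Normal_Form.Matrix\<close>, whose order \<open>\<le>\<close> is componentwise. Points of the
  input space, where convex hulls and concavity are needed, live in \<open>real ^ 'n\<close>. An enumeration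
  \<open>e\<close> of the index type \<open>'n\<close> identifies the two representations of the input vector.
\<close>

definition coords :: "(nat \<Rightarrow> 'n) \<Rightarrow> real ^ 'n \<Rightarrow> real Matrix.vec" where
  "coords e x = Matrix.vec CARD('n) (\<lambda>i. vec_nth x (e i))"

record icnn =
  depth :: nat
  width :: "nat \<Rightarrow> nat"
  W :: "nat \<Rightarrow> real mat"
  S :: "nat \<Rightarrow> real mat"
  b :: "nat \<Rightarrow> real Matrix.vec"

definition valid_icnn :: "nat \<Rightarrow> icnn \<Rightarrow> bool" where
  "valid_icnn n N \<longleftrightarrow>
     1 \<le> depth N \<and> width N 0 = n \<and> width N (depth N) = 1 \<and>
     (\<forall>k<depth N. W N k \<in> carrier_mat (width N (k + 1)) (width N k)
                \<and> S N k \<in> carrier_mat (width N (k + 1)) n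
                \<and> b N k \<in> carrier_vec (width N (k + 1))) \<and>
     W N 0 = 0\<^sub>m (width N 1) (width N 0) \<and>
     (\<forall>k. 1 \<le> k \<and> k < depth N \<longrightarrow> 0\<^sub>m (width N (k + 1)) (width N k) \<le> W N k)"

definition affine_layer :: "icnn \<Rightarrow> nat \<Rightarrow> real Matrix.vec \<Rightarrow> real Matrix.vec \<Rightarrow> real Matrix.vec" where
  "affine_layer N k z0 z = W N k *\<^sub>v z + S N k *\<^sub>v z0 + b N k"

definition relu :: "real Matrix.vec \<Rightarrow> real Matrix.vec" where
  "relu v = map_vec (\<lambda>t. max 0 t) v"

fun hidden_layer :: "icnn \<Rightarrow> real Matrix.vec \<Rightarrow> nat \<Rightarrow> real Matrix.vec" where
  "hidden_layer N z0 0 = z0"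
| "hidden_layer N z0 (Suc k) = relu (affine_layer N k z0 (hidden_layer N z0 k))"

text \<open>The output layer has no activation; it is a vector of dimension one, read off at index 0.\<close>

definition icnn_fun :: "(nat \<Rightarrow> 'n) \<Rightarrow> icnn \<Rightarrow> real ^ 'n \<Rightarrow> real" where
  "icnn_fun e N x =
     (let z0 = coords e x; k = depth N - 1
      in vec_index (affine_layer N k z0 (hidden_layer N z0 k)) 0)"

text \<open>
  The \<open>2 ^ CARD('n)\<close> vertices are indexed by the set \<open>J\<close> of coordinates at which the upper bound is
  chosen.
\<close>

definition vertex :: "real ^ 'n \<Rightarrow> real ^ 'n \<Rightarrow> 'n set \<Rightarrow> real ^ 'n" where
  "vertex l u J = (\<chi> j. if j \<in> J then vec_nth u j else vec_nth l j)"

definition concave_envelope :: "'a::real_vector set \<Rightarrow> ('a \<Rightarrow> real) \<Rightarrow> 'a \<Rightarrow> real" where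
  "concave_envelope X f x = Inf {\<phi> x |\<phi>. concave_on X \<phi> \<and> (\<forall>v\<in>X. f v \<le> \<phi> v)}"

text \<open>
  On its domain, the pointwise infimum agrees with the smallest concave majorant whenever the latter
  exists.
\<close>

lemma concave_envelope_eqI:
  assumes "concave_on X \<psi>" and "\<forall>v\<in>X. f v \<le> \<psi> v"
    and "\<And>\<phi>. concave_on X \<phi> \<Longrightarrow> \<forall>v\<in>X. f v \<le> \<phi> v \<Longrightarrow> \<forall>v\<in>X. \<psi> v \<le> \<phi> v"
    and "x \<in> X"
  shows "concave_envelope X f x = \<psi> x"
  unfolding concave_envelope_def
  by (rule cInf_eq_minimum) (use assms in blast)+

text \<open>Only the components \<open>z 0, \<dots>, z (depth N)\<close> of the sequence \<open>z\<close> are used.\<close>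

definition epigraph_envelope_constraints ::
  "(nat \<Rightarrow> 'n::finite) \<Rightarrow> icnn \<Rightarrow> real ^ 'n \<Rightarrow> real ^ 'n \<Rightarrow>
   real ^ 'n \<Rightarrow> real \<Rightarrow> (nat \<Rightarrow> real Matrix.vec) \<Rightarrow> ('n set \<Rightarrow> real) \<Rightarrow> bool" where
  "epigraph_envelope_constraints e N l u x y z \<alpha> \<longleftrightarrow>
     (\<forall>k\<le>depth N. z k \<in> carrier_vec (width N k)) \<and>
     y = vec_index (z (depth N)) 0 \<and>
     coords e x = z 0 \<and>
     (\<forall>k<depth N. affine_layer N k (z 0) (z k) \<le> z (k + 1)) \<and>
     (\<forall>k. 1 \<le> k \<and> k < depth N \<longrightarrow> 0\<^sub>v (width N k) \<le> z k) \<and>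
     x = (\<Sum>J\<in>UNIV. \<alpha> J *\<^sub>R vertex l u J) \<and>
     (\<Sum>J\<in>UNIV. \<alpha> J) = 1 \<and>
     vec_index (z (depth N)) 0 \<le> (\<Sum>J\<in>UNIV. \<alpha> J * icnn_fun e N (vertex l u J)) \<and>
     (\<forall>J. 0 \<le> \<alpha> J)"

definition projected_region ::
  "(nat \<Rightarrow> 'n::finite) \<Rightarrow> icnn \<Rightarrow> real ^ 'n \<Rightarrow> real ^ 'n \<Rightarrow> ((real ^ 'n) \<times> real) set" where
  "projected_region e N l u =
     {(x, y). x \<in> cbox l u \<and> (\<exists>z \<alpha>. epigraph_envelope_constraints e N l u x y z \<alpha>)}"

definition graph_over :: "'a set \<Rightarrow> ('a \<Rightarrow> real) \<Rightarrow> ('a \<times> real) set" where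
  "graph_over X f = {(x, f x) |x. x \<in> X}"

text \<open>Feasible sets of the original problem and of its reformulation in \<open>(x, y, z, \<alpha>)\<close>.\<close>

definition feasible_P ::
  "((real ^ 'n) \<times> real \<Rightarrow> real ^ 'm) \<Rightarrow> (nat \<Rightarrow> 'n::finite) \<Rightarrow> icnn \<Rightarrow> real ^ 'n \<Rightarrow> real ^ 'n \<Rightarrow>
   ((real ^ 'n) \<times> real) set" where
  "feasible_P g e N l u = {(x, y). g (x, y) \<le> 0 \<and> y = icnn_fun e N x \<and> x \<in> cbox l u}"

definition feasible_R ::
  "((real ^ 'n) \<times> real \<Rightarrow> real ^ 'm) \<Rightarrow> (nat \<Rightarrow> 'n::finite) \<Rightarrow> icnn \<Rightarrow> real ^ 'n \<Rightarrow> real ^ 'n \<Rightarrow>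
   ((real ^ 'n) \<times> real \<times> (nat \<Rightarrow> real Matrix.vec) \<times> ('n set \<Rightarrow> real)) set" where
  "feasible_R g e N l u =
     {(x, y, z, \<alpha>). g (x, y) \<le> 0 \<and> x \<in> cbox l u \<and> epigraph_envelope_constraints e N l u x y z \<alpha>}"

text \<open>
  Relaxing the network constraint alone: \<open>g (x, y) \<le> 0\<close> and \<open>x \<in> X\<close> stay, while \<open>y = f x\<close> is replaced
  by \<open>(x, y) \<in> C\<close>. As usual for continuous relaxations, \<open>C\<close> is convex; without convexity the graph
  itself would be admissible and there would be nothing to relax.
\<close>

definition continuous_relaxation :: "('a::real_vector \<times> real) set \<Rightarrow> ('a \<times> real) set \<Rightarrow> bool" where
  "continuous_relaxation G C \<longleftrightarrow> convex C \<and> G \<subseteq> C"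

definition feasible_relaxed ::
  "('a \<times> real \<Rightarrow> real ^ 'm) \<Rightarrow> 'a set \<Rightarrow> ('a \<times> real) set \<Rightarrow> ('a \<times> real) set" where
  "feasible_relaxed g X C = {(x, y). g (x, y) \<le> 0 \<and> x \<in> X \<and> (x, y) \<in> C}"

text \<open>Extended real, so that infeasible and unbounded problems also have a value.\<close>

definition opt_value :: "('a \<Rightarrow> real) \<Rightarrow> 'a set \<Rightarrow> ereal" where
  "opt_value obj A = (INF p\<in>A. ereal (obj p))"

end

theory Submission
  imports Defs
begin

text \<open>
  Since \<open>W k \<ge> 0\<close> and the rectifier is monotone and convex, the forward pass is the componentwise
  least solution of the epigraph inequalities, and it is convex in the input. Hence these inequalities
  describe exactly \<open>f x \<le> y\<close>. By convexity of \<open>f\<close>, the upper boundary of the convex hull of the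
  graph is that of the polytope spanned by the lifted vertices \<open>(v, f v)\<close>, which is the concave
  envelope; each vertical fibre of the hull is the segment between \<open>f x\<close> and the envelope.
\<close>

subsection \<open>Concave envelopes of convex functions on polytopes\<close>

text \<open>Weights are indexed by the type \<open>'i\<close> rather than by points, as in the
  system (C), so vertices of a degenerate box that coincide keep separate weights.\<close>

lemma convex_hull_range_eq:
  fixes p :: "'i::finite \<Rightarrow> 'a::real_vector"
  shows "convex hull (range p) =
    {\<Sum>i\<in>UNIV. \<alpha> i *\<^sub>R p i |\<alpha>. (\<forall>i. 0 \<le> \<alpha> i) \<and> (\<Sum>i\<in>UNIV. \<alpha> i) = 1}" (is "_ = ?T")
proof
  have "p j \<in> ?T" for j
    by (rule CollectI, rule exI[of _ "\<lambda>i. if i = j then 1 else 0"]) (simp add: if_distrib[of "\<lambda>c. c *\<^sub>R _"] cong: if_cong)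
  moreover have "convex ?T"
  proof (rule convexI)
    fix x y :: 'a and s t :: real
    assume "x \<in> ?T" "y \<in> ?T" and st: "0 \<le> s" "0 \<le> t" "s + t = 1"
    then obtain \<alpha> \<beta> where
      \<alpha>: "\<forall>i. 0 \<le> \<alpha> i" "(\<Sum>i\<in>UNIV. \<alpha> i) = 1" "x = (\<Sum>i\<in>UNIV. \<alpha> i *\<^sub>R p i)" and
      \<beta>: "\<forall>i. 0 \<le> \<beta> i" "(\<Sum>i\<in>UNIV. \<beta> i) = 1" "y = (\<Sum>i\<in>UNIV. \<beta> i *\<^sub>R p i)"
      by blast
    show "s *\<^sub>R x + t *\<^sub>R y \<in> ?T"
      by (rule CollectI, rule exI[of _ "\<lambda>i. s * \<alpha> i + t * \<beta> i"])
        (use \<alpha> \<beta> st in \<open>simp add: sum.distrib scaleR_add_left scaleR_sum_right flip: sum_distrib_left\<close>)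
  qed
  ultimately show "convex hull (range p) \<subseteq> ?T"
    by (intro hull_minimal) blast+
  show "?T \<subseteq> convex hull (range p)"
    by (auto intro!: convex_sum simp: hull_inc)
qed

lemma convex_on_sum_range:
  fixes p :: "'i::finite \<Rightarrow> 'a::real_vector"
  assumes "convex_on X f" "range p \<subseteq> X" "\<forall>i. 0 \<le> \<alpha> i" "(\<Sum>i\<in>UNIV. \<alpha> i) = 1"
  shows "f (\<Sum>i\<in>UNIV. \<alpha> i *\<^sub>R p i) \<le> (\<Sum>i\<in>UNIV. \<alpha> i * f (p i))"
  using assms by (intro convex_on_sum) (auto dest: convex_on_imp_convex)

text \<open>The right side is the linear program for the envelope, written as an inequality so that
  it matches the \<alpha>-part of (C). Left to right, the program's value function is itself a
  concave majorant and its maximum is attained; right to left, Jensen's inequality bounds every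
  concave majorant from below.\<close>

lemma le_concave_envelope_iff:
  fixes p :: "'i::finite \<Rightarrow> 'a::euclidean_space"
  assumes f: "convex_on X f" and X: "X = convex hull (range p)" and x: "x \<in> X"
  shows "y \<le> concave_envelope X f x \<longleftrightarrow>
    (\<exists>\<alpha>. x = (\<Sum>i\<in>UNIV. \<alpha> i *\<^sub>R p i) \<and> (\<Sum>i\<in>UNIV. \<alpha> i) = 1 \<and>
         y \<le> (\<Sum>i\<in>UNIV. \<alpha> i * f (p i)) \<and> (\<forall>i. 0 \<le> \<alpha> i))" (is "_ \<longleftrightarrow> ?R")
proof
  have pX: "range p \<subseteq> X" and cX: "convex X"
    by (auto simp: X hull_inc)
  let ?A = "{\<phi> x |\<phi>. concave_on X \<phi> \<and> (\<forall>v\<in>X. f v \<le> \<phi> v)}"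
  {
    \<comment> \<open>The polytope of lifted vertices: its fibre over \<open>v\<close> consists of
      the objective values that the linear program takes at \<open>v\<close>.\<close>
    define P where "P = convex hull (range (\<lambda>i. (p i, f (p i))))"
    have P_eq: "P = {(\<Sum>i\<in>UNIV. \<alpha> i *\<^sub>R p i, \<Sum>i\<in>UNIV. \<alpha> i * f (p i)) |\<alpha>.
        (\<forall>i. 0 \<le> \<alpha> i) \<and> (\<Sum>i\<in>UNIV. \<alpha> i) = 1}"
      unfolding P_def convex_hull_range_eq by (simp add: sum_prod)
    have "compact P"
      unfolding P_def by (intro finite_imp_compact_convex_hull) simp
    \<comment> \<open>Jensen's inequality for \<open>f\<close> serves twice: it makes every fibre
      nonempty, and later shows that the upper boundary majorizes \<open>f\<close>.\<close>
    have ex_above: "\<exists>t. (v, t) \<in> P \<and> f v \<le> t" if v: "v \<in> X" for v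
    proof -
      obtain \<alpha> where "\<forall>i. 0 \<le> \<alpha> i" "(\<Sum>i\<in>UNIV. \<alpha> i) = 1" "v = (\<Sum>i\<in>UNIV. \<alpha> i *\<^sub>R p i)"
        using v unfolding X convex_hull_range_eq by blast
      then show ?thesis
        using convex_on_sum_range[OF f pX] unfolding P_eq by blast
    qed
    have "\<exists>m. (v, m) \<in> P \<and> (\<forall>t. (v, t) \<in> P \<longrightarrow> t \<le> m)" if v: "v \<in> X" for v
    proof -
      \<comment> \<open>Compactness makes the top of the fibre an attained maximum, so a single
        weight vector can witness it.\<close>
      have "compact (P \<inter> {v} \<times> UNIV)"
        by (intro compact_Int_closed \<open>compact P\<close> closed_Times) auto
      then have "compact (snd ` (P \<inter> {v} \<times> UNIV))"
        by (intro compact_continuous_image continuous_intros)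
      moreover have "snd ` (P \<inter> {v} \<times> UNIV) \<noteq> {}"
        using ex_above[OF v] by blast
      ultimately obtain m where m: "m \<in> snd ` (P \<inter> {v} \<times> UNIV)" "\<forall>t\<in>snd ` (P \<inter> {v} \<times> UNIV). t \<le> m"
        using compact_attains_sup by blast
      have "(v, m) \<in> P"
        using m(1) by auto
      moreover have "t \<le> m" if "(v, t) \<in> P" for t
        using m(2) that by force
      ultimately show ?thesis by blast
    qed
    then obtain \<psi> where \<psi>: "\<And>v. v \<in> X \<Longrightarrow> (v, \<psi> v) \<in> P" "\<And>v t. v \<in> X \<Longrightarrow> (v, t) \<in> P \<Longrightarrow> t \<le> \<psi> v"
      by metis
    have "concave_on X \<psi>"
      unfolding concave_on_iff
    proof (intro conjI ballI allI impI)
      fix v w and s t :: real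
      assume vw: "v \<in> X" "w \<in> X" and st: "0 \<le> s" "0 \<le> t" "s + t = 1"
      \<comment> \<open>Mixing two top points stays inside \<open>P\<close>, hence below the top of
        the fibre over the mixed base point; this is concavity of \<open>\<psi>\<close>.\<close>
      have "s *\<^sub>R (v, \<psi> v) + t *\<^sub>R (w, \<psi> w) \<in> P"
        using vw st \<psi>(1) by (intro convexD) (auto simp: P_def)
      then show "s * \<psi> v + t * \<psi> w \<le> \<psi> (s *\<^sub>R v + t *\<^sub>R w)"
        using vw st cX by (intro \<psi>(2) convexD) auto
    qed (rule cX)
    moreover have "\<forall>v\<in>X. f v \<le> \<psi> v"
      using ex_above \<psi>(2) order_trans by blast
    ultimately have "concave_envelope X f x \<le> \<psi> x"
      unfolding concave_envelope_def using x by (intro cInf_lower bdd_belowI[of _ "f x"]) auto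
    moreover obtain \<alpha> where "\<forall>i. 0 \<le> \<alpha> i" "(\<Sum>i\<in>UNIV. \<alpha> i) = 1" "x = (\<Sum>i\<in>UNIV. \<alpha> i *\<^sub>R p i)"
        "\<psi> x = (\<Sum>i\<in>UNIV. \<alpha> i * f (p i))"
      using \<psi>(1)[OF x] unfolding P_eq by blast
    moreover assume "y \<le> concave_envelope X f x"
    ultimately show ?R
      by (metis order_trans)
  next
    assume ?R
    then obtain \<alpha> where \<alpha>: "x = (\<Sum>i\<in>UNIV. \<alpha> i *\<^sub>R p i)" "(\<Sum>i\<in>UNIV. \<alpha> i) = 1"
        "y \<le> (\<Sum>i\<in>UNIV. \<alpha> i * f (p i))" "\<forall>i. 0 \<le> \<alpha> i"
      by blast
    have "y \<le> \<phi> x" if \<phi>: "concave_on X \<phi>" "\<forall>v\<in>X. f v \<le> \<phi> v" for \<phi>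
    proof -
      have "(\<Sum>i\<in>UNIV. \<alpha> i * f (p i)) \<le> (\<Sum>i\<in>UNIV. \<alpha> i * \<phi> (p i))"
        using \<phi>(2) pX \<alpha>(4) by (intro sum_mono mult_left_mono) auto
      also have "\<dots> \<le> \<phi> x"
        using convex_on_sum_range[OF \<phi>(1)[unfolded concave_on_def] pX \<alpha>(4,2)] \<alpha>(1)
        by (simp add: sum_negf)
      finally show ?thesis
        using \<alpha>(3) by simp
    qed
    \<comment> \<open>A convex function on the hull is bounded by its largest vertex value. That
      constant is a concave majorant, so the infimum defining the envelope ranges over a nonempty
      set.\<close>
    moreover have "\<forall>v\<in>X. f v \<le> Max (range (f \<circ> p))"
      unfolding X by (rule convex_on_convex_hull_bound[OF f[unfolded X]]) auto
    then have "?A \<noteq> {}"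
      using concave_on_const[of X "Max (range (f \<circ> p))"] cX by auto
    ultimately show "y \<le> concave_envelope X f x"
      unfolding concave_envelope_def by (intro cInf_greatest) auto
  }
qed

text \<open>One inclusion holds because the region is convex and contains the graph, the other
  because each of its points lies between two points of the hull on the same vertical line.\<close>

lemma convex_hull_graph_over_polytope:
  fixes p :: "'i::finite \<Rightarrow> 'a::euclidean_space"
  assumes f: "convex_on X f" and X: "X = convex hull (range p)"
  shows "convex hull (graph_over X f) =
    {(x, y). x \<in> X \<and> f x \<le> y \<and> y \<le> concave_envelope X f x}" (is "?H = ?V")
proof
  have pX: "range p \<subseteq> X" and cX: "convex X"
    by (auto simp: X hull_inc)
  have "convex ?V"
  proof (rule convexI)
    fix P Q :: "'a \<times> real" and s t :: real
    assume PQ: "P \<in> ?V" "Q \<in> ?V" and st: "0 \<le> s" "0 \<le> t" "s + t = 1"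
    obtain v a w c where P: "P = (v, a)" and Q: "Q = (w, c)"
      by (metis surj_pair)
    have va: "v \<in> X" "f v \<le> a" "a \<le> concave_envelope X f v"
      and wc: "w \<in> X" "f w \<le> c" "c \<le> concave_envelope X f w"
      using PQ P Q by auto
    have mem: "s *\<^sub>R v + t *\<^sub>R w \<in> X"
      using cX va wc st by (intro convexD)
    obtain \<alpha> where \<alpha>: "v = (\<Sum>i\<in>UNIV. \<alpha> i *\<^sub>R p i)" "(\<Sum>i\<in>UNIV. \<alpha> i) = 1"
        "a \<le> (\<Sum>i\<in>UNIV. \<alpha> i * f (p i))" "\<forall>i. 0 \<le> \<alpha> i"
      using va(3) le_concave_envelope_iff[OF f X va(1)] by blast
    obtain \<beta> where \<beta>: "w = (\<Sum>i\<in>UNIV. \<beta> i *\<^sub>R p i)" "(\<Sum>i\<in>UNIV. \<beta> i) = 1"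
        "c \<le> (\<Sum>i\<in>UNIV. \<beta> i * f (p i))" "\<forall>i. 0 \<le> \<beta> i"
      using wc(3) le_concave_envelope_iff[OF f X wc(1)] by blast
    have "s * a + t * c \<le> s * (\<Sum>i\<in>UNIV. \<alpha> i * f (p i)) + t * (\<Sum>i\<in>UNIV. \<beta> i * f (p i))"
      using \<alpha>(3) \<beta>(3) st by (intro add_mono mult_left_mono)
    also have "\<dots> = (\<Sum>i\<in>UNIV. (s * \<alpha> i + t * \<beta> i) * f (p i))"
      by (simp add: sum_distrib_left sum.distrib algebra_simps)
    \<comment> \<open>Mixing the two weight vectors gives a feasible point of the linear program at
      the mixed base point.\<close>
    finally have "s * a + t * c \<le> concave_envelope X f (s *\<^sub>R v + t *\<^sub>R w)"
      unfolding le_concave_envelope_iff[OF f X mem] using \<alpha> \<beta> st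
      by (intro exI[of _ "\<lambda>i. s * \<alpha> i + t * \<beta> i"])
        (simp add: sum.distrib scaleR_add_left scaleR_sum_right flip: sum_distrib_left)
    moreover have "f (s *\<^sub>R v + t *\<^sub>R w) \<le> s * f v + t * f w"
      using f va(1) wc(1) st unfolding convex_on_def by blast
    moreover have "s * f v + t * f w \<le> s * a + t * c"
      using va wc st by (intro add_mono mult_left_mono)
    ultimately show "s *\<^sub>R P + t *\<^sub>R Q \<in> ?V"
      using mem by (simp add: P Q)
  qed
  moreover have "graph_over X f \<subseteq> ?V"
  proof -
    have "f x \<le> concave_envelope X f x" if x: "x \<in> X" for x
    proof -
      obtain \<alpha> where "\<forall>i. 0 \<le> \<alpha> i" "(\<Sum>i\<in>UNIV. \<alpha> i) = 1" "x = (\<Sum>i\<in>UNIV. \<alpha> i *\<^sub>R p i)"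
        using x unfolding X convex_hull_range_eq by blast
      then show ?thesis
        using convex_on_sum_range[OF f pX] le_concave_envelope_iff[OF f X x] by blast
    qed
    then show ?thesis
      by (auto simp: graph_over_def)
  qed
  ultimately show "?H \<subseteq> ?V"
    by (intro hull_minimal)
  show "?V \<subseteq> ?H"
  proof clarify
    fix x y
    assume x: "x \<in> X" and y: "f x \<le> y" "y \<le> concave_envelope X f x"
    obtain \<alpha> where \<alpha>: "x = (\<Sum>i\<in>UNIV. \<alpha> i *\<^sub>R p i)" "(\<Sum>i\<in>UNIV. \<alpha> i) = 1"
        "y \<le> (\<Sum>i\<in>UNIV. \<alpha> i * f (p i))" "\<forall>i. 0 \<le> \<alpha> i"
      using y(2) le_concave_envelope_iff[OF f X x] by blast
    \<comment> \<open>\<open>q\<close> may lie strictly below the envelope; a hull point at height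
      at least \<open>y\<close> over \<open>x\<close> suffices.\<close>
    define q where "q = (\<Sum>i\<in>UNIV. \<alpha> i * f (p i))"
    have "(\<Sum>i\<in>UNIV. \<alpha> i *\<^sub>R (p i, f (p i))) \<in> ?H"
      using \<alpha> pX by (intro convex_sum) (auto simp: graph_over_def image_subset_iff intro!: hull_inc)
    then have hi: "(x, q) \<in> ?H"
      by (simp add: sum_prod \<alpha>(1) q_def)
    have lo: "(x, f x) \<in> ?H"
      using x by (auto simp: graph_over_def intro!: hull_inc)
    have "y \<in> closed_segment (f x) q"
      using y(1) \<alpha>(3) by (simp add: closed_segment_eq_real_ivl q_def)
    then obtain t where t: "0 \<le> t" "t \<le> 1" "y = (1 - t) *\<^sub>R f x + t *\<^sub>R q"
      by (auto simp: closed_segment_def)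
    have "(1 - t) *\<^sub>R (x, f x) + t *\<^sub>R (x, q) \<in> ?H"
      using hi lo t by (intro convexD) auto
    then show "(x, y) \<in> ?H"
      using t(3) by (simp flip: scaleR_add_left)
  qed
qed

section \<open>Boxes as polytopes\<close>

lemma convex_hull_vertex_eq_cbox:
  fixes l u :: "real ^ 'n"
  assumes "cbox l u \<noteq> {}"
  shows "convex hull (range (vertex l u)) = cbox l u"
proof
  have lu: "l $ j \<le> u $ j" for j
    using assms unfolding interval_ne_empty_cart by blast
  then show "convex hull (range (vertex l u)) \<subseteq> cbox l u"
    by (intro hull_minimal) (auto simp: vertex_def mem_box_cart)
  \<comment> \<open>Induction on a set \<open>T\<close> of coordinates that may lie strictly between
    their bounds; taking all coordinates for \<open>T\<close> gives the claim.\<close>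
  have "x \<in> convex hull (range (vertex l u))"
    if "finite T" "x \<in> cbox l u" "\<forall>j. j \<notin> T \<longrightarrow> x $ j = l $ j \<or> x $ j = u $ j" for T x
    using that
  proof (induction T arbitrary: x rule: finite_induct)
    case empty
    have "x = vertex l u {j. x $ j = u $ j}"
      using empty by (auto simp: vertex_def Finite_Cartesian_Product.vec_eq_iff)
    then show ?case
      by (metis hull_inc rangeI)
  next
    case (insert a T)
    \<comment> \<open>Pushing coordinate \<open>a\<close> to either bound removes it from the free
      set, and \<open>x\<close> lies on the segment between the two resulting points.\<close>
    define w where "w c = (\<chi> j. if j = a then c else x $ j)" for c
    have w: "w c \<in> convex hull (range (vertex l u))" if "c = l $ a \<or> c = u $ a" for c
      using insert.prems that lu by (intro insert.IH) (auto simp: w_def mem_box_cart)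
    have "x $ a \<in> closed_segment (l $ a) (u $ a)"
      using insert.prems(1) lu by (simp add: closed_segment_eq_real_ivl mem_box_cart)
    then obtain t where t: "0 \<le> t" "t \<le> 1" "x $ a = (1 - t) *\<^sub>R l $ a + t *\<^sub>R u $ a"
      by (auto simp: closed_segment_def)
    have "x = (1 - t) *\<^sub>R w (l $ a) + t *\<^sub>R w (u $ a)"
      using t(3) by (simp add: w_def Finite_Cartesian_Product.vec_eq_iff algebra_simps)
    also have "\<dots> \<in> convex hull (range (vertex l u))"
      using w t by (intro convexD) auto
    finally show ?case .
  qed
  from this[OF finite] show "cbox l u \<subseteq> convex hull (range (vertex l u))"
    by blast
qed

subsection \<open>Input convex neural networks\<close>

lemma coords_carrier [simp]: "coords e (x :: real ^ 'n) \<in> carrier_vec CARD('n)"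
  by (simp add: coords_def)

lemma coords_index [simp]: "i < CARD('n) \<Longrightarrow> vec_index (coords e (x :: real ^ 'n)) i = x $ e i"
  by (simp add: coords_def)

lemma layer_carriers:
  assumes "valid_icnn n N" "k < depth N"
  shows "W N k \<in> carrier_mat (width N (k + 1)) (width N k)"
    and "S N k \<in> carrier_mat (width N (k + 1)) n"
    and "b N k \<in> carrier_vec (width N (k + 1))"
  using assms unfolding valid_icnn_def by blast+

text \<open>Vector addition takes the dimension of its right summand, so the bias
  \<open>b N k\<close> determines the dimension here.\<close>

lemma dim_affine_layer:
  assumes "valid_icnn n N" "k < depth N"
  shows "dim_vec (affine_layer N k z0 z) = width N (Suc k)"
  using carrier_vecD[OF layer_carriers(3)[OF assms]] by (simp add: affine_layer_def)

lemma affine_layer_index: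
  assumes "valid_icnn n N" "k < depth N" "i < width N (k + 1)"
    and "z0 \<in> carrier_vec n" "z \<in> carrier_vec (width N k)"
  shows "vec_index (affine_layer N k z0 z) i =
    (\<Sum>j<width N k. W N k $$ (i, j) * vec_index z j) + (\<Sum>j<n. S N k $$ (i, j) * vec_index z0 j)
    + vec_index (b N k) i"
  using layer_carriers[OF assms(1,2)] assms(3-5)
  by (simp add: affine_layer_def scalar_prod_def atLeast0LessThan)

section \<open>Monotonicity and minimality of the forward pass\<close>

lemma weights_nonneg:
  assumes N: "valid_icnn n N" and "k < depth N" "i < width N (k + 1)" "j < width N k"
  shows "0 \<le> W N k $$ (i, j)"
proof (cases "k = 0")
  case True
  then show ?thesis
    using assms by (simp add: valid_icnn_def)
next
  case False
  then have "0\<^sub>m (width N (k + 1)) (width N k) \<le> W N k"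
    using assms by (simp add: valid_icnn_def)
  then show ?thesis
    using assms(3,4) by (auto simp: less_eq_mat_def)
qed

text \<open>The skip term and the bias are common to both sides; what remains is a sum with
  non-negative weights.\<close>

lemma affine_layer_mono:
  assumes N: "valid_icnn n N" and k: "k < depth N"
    and z0: "z0 \<in> carrier_vec n" and z: "z \<in> carrier_vec (width N k)" and le: "z \<le> z'"
  shows "affine_layer N k z0 z \<le> affine_layer N k z0 z'"
proof -
  have z': "z' \<in> carrier_vec (width N k)" and le': "\<And>j. j < width N k \<Longrightarrow> vec_index z j \<le> vec_index z' j"
    using z le by (auto simp: less_eq_vec_def)
  have "vec_index (affine_layer N k z0 z) i \<le> vec_index (affine_layer N k z0 z') i"
    if i: "i < width N (k + 1)" for i
    unfolding affine_layer_index[OF N k i z0 z] affine_layer_index[OF N k i z0 z']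
    using weights_nonneg[OF N k i] le' by (intro add_right_mono sum_mono mult_left_mono) auto
  then show ?thesis
    by (simp add: less_eq_vec_def dim_affine_layer[OF N k])
qed

lemma hidden_layer_carrier:
  assumes N: "valid_icnn n N" and z0: "z0 \<in> carrier_vec n" and k: "k \<le> depth N"
  shows "hidden_layer N z0 k \<in> carrier_vec (width N k)"
proof (cases k)
  case 0
  then show ?thesis
    using z0 N by (simp add: valid_icnn_def)
next
  case (Suc j)
  then show ?thesis
    using k by (intro carrier_vecI) (simp add: relu_def dim_affine_layer[OF N])
qed

text \<open>Monotonicity carries the bound through \<open>W\<close>, and then \<open>step\<close>
  and \<open>nonneg\<close> bound the two arguments of the maximum in the rectifier. The range stops
  before the output layer, which has neither rectifier nor sign constraint.\<close>

lemma hidden_layer_least: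
  assumes N: "valid_icnn n N" and z0: "z 0 \<in> carrier_vec n"
    and step: "\<And>k. k < depth N \<Longrightarrow> affine_layer N k (z 0) (z k) \<le> z (k + 1)"
    and nonneg: "\<And>k. 1 \<le> k \<Longrightarrow> k < depth N \<Longrightarrow> 0\<^sub>v (width N k) \<le> z k"
  shows "k < depth N \<Longrightarrow> hidden_layer N (z 0) k \<le> z k"
proof (induction k)
  case (Suc k)
  then have k: "k < depth N" and le: "hidden_layer N (z 0) k \<le> z k"
    by auto
  have "affine_layer N k (z 0) (hidden_layer N (z 0) k) \<le> affine_layer N k (z 0) (z k)"
    using k by (intro affine_layer_mono[OF N k z0 _ le] hidden_layer_carrier[OF N z0]) simp
  also have "\<dots> \<le> z (Suc k)"
    using step[OF k] by simp
  finally show ?case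
    using nonneg[of "Suc k"] Suc.prems by (auto simp: less_eq_vec_def relu_def)
qed simp

section \<open>Convexity of the network in its input\<close>

lemma convex_on_sum_fun:
  assumes "finite A" "convex X" "\<And>i. i \<in> A \<Longrightarrow> convex_on X (f i)"
  shows "convex_on X (\<lambda>x. \<Sum>i\<in>A. f i x)"
  using assms by (induction A rule: finite_induct) (auto simp: convex_on_const)

lemma convex_on_max:
  assumes "convex_on X f" "convex_on X g"
  shows "convex_on X (\<lambda>x. max (f x) (g x))"
proof (rule convex_onI)
  fix t x y
  assume t: "(0::real) < t" "t < 1" and xy: "x \<in> X" "y \<in> X"
  \<comment> \<open>To be applied with \<open>h\<close> equal to \<open>f\<close> and to
    \<open>g\<close>, both of which lie below the maximum.\<close>
  have "h ((1 - t) *\<^sub>R x + t *\<^sub>R y) \<le> (1 - t) * max (f x) (g x) + t * max (f y) (g y)"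
    if h: "convex_on X h" "h \<le> (\<lambda>v. max (f v) (g v))" for h
  proof -
    have "h ((1 - t) *\<^sub>R x + t *\<^sub>R y) \<le> (1 - t) * h x + t * h y"
      using t xy by (intro convex_onD[OF h(1)]) auto
    also have "\<dots> \<le> (1 - t) * max (f x) (g x) + t * max (f y) (g y)"
      using t h(2) by (intro add_mono mult_left_mono) (auto simp: le_fun_def)
    finally show ?thesis .
  qed
  then show "max (f ((1 - t) *\<^sub>R x + t *\<^sub>R y)) (g ((1 - t) *\<^sub>R x + t *\<^sub>R y))
      \<le> (1 - t) * max (f x) (g x) + t * max (f y) (g y)"
    using assms by (intro max.boundedI) (simp_all add: le_fun_def)
qed (use assms convex_on_imp_convex in auto)

text \<open>Non-negative combinations preserve convexity, and the skip term is linear in the input,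
  hence convex for either sign of the entries of \<open>S\<close>.\<close>

lemma convex_on_affine_layer:
  fixes e :: "nat \<Rightarrow> 'n::finite"
  assumes N: "valid_icnn CARD('n) N" and k: "k < depth N" and i: "i < width N (k + 1)"
    and F: "\<And>x. F x \<in> carrier_vec (width N k)"
    and cF: "\<And>j. j < width N k \<Longrightarrow> convex_on UNIV (\<lambda>x. vec_index (F x) j)"
  shows "convex_on UNIV (\<lambda>x. vec_index (affine_layer N k (coords e x) (F x)) i)"
proof -
  have "convex_on UNIV (\<lambda>x. \<Sum>j<width N k. W N k $$ (i, j) * vec_index (F x) j)"
    using weights_nonneg[OF N k i] cF by (intro convex_on_sum_fun convex_on_cmul) auto
  moreover have "convex_on UNIV (\<lambda>x :: real ^ 'n. \<Sum>j<CARD('n). S N k $$ (i, j) * x $ e j)"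
    by (intro convex_on_sum_fun) (auto simp: convex_on_def algebra_simps)
  ultimately have "convex_on UNIV (\<lambda>x. (\<Sum>j<width N k. W N k $$ (i, j) * vec_index (F x) j)
      + (\<Sum>j<CARD('n). S N k $$ (i, j) * x $ e j) + vec_index (b N k) i)"
    by (intro convex_on_add) (auto simp: convex_on_const)
  then show ?thesis
    by (simp add: affine_layer_index[OF N k i coords_carrier F])
qed

lemma convex_on_hidden_layer:
  fixes e :: "nat \<Rightarrow> 'n::finite"
  assumes N: "valid_icnn CARD('n) N"
  shows "k < depth N \<Longrightarrow> i < width N k \<Longrightarrow>
    convex_on UNIV (\<lambda>x. vec_index (hidden_layer N (coords e x) k) i)"
proof (induction k arbitrary: i)
  \<comment> \<open>Layer 0 is the unrectified input, so its components are coordinate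
    functionals.\<close>
  case 0
  then have "i < CARD('n)"
    using N by (simp add: valid_icnn_def)
  then show ?case
    by (simp add: convex_on_def)
next
  case (Suc k)
  then have k: "k < depth N"
    by simp
  have "convex_on UNIV (\<lambda>x. vec_index (affine_layer N k (coords e x) (hidden_layer N (coords e x) k)) i)"
    using Suc k by (intro convex_on_affine_layer[OF N] hidden_layer_carrier[OF N]) auto
  then show ?case
    using Suc.prems dim_affine_layer[OF N k]
    by (simp add: relu_def convex_on_const convex_on_max)
qed

lemma convex_on_icnn_fun:
  fixes e :: "nat \<Rightarrow> 'n::finite"
  assumes N: "valid_icnn CARD('n) N"
  shows "convex_on UNIV (icnn_fun e N)"
proof -
  define k where "k = depth N - 1"
  have k: "k < depth N" "width N (k + 1) = 1"
    using N by (auto simp: k_def valid_icnn_def)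
  have "convex_on UNIV (\<lambda>x. vec_index (affine_layer N k (coords e x) (hidden_layer N (coords e x) k)) 0)"
    using k by (intro convex_on_affine_layer[OF N] hidden_layer_carrier[OF N] convex_on_hidden_layer[OF N]) auto
  then show ?thesis
    by (simp add: icnn_fun_def[abs_def] Let_def k_def)
qed

text \<open>This isolates the z-part of (C). Minimality of the forward pass gives one direction; for
  the other, all slack is placed in the output component.\<close>

lemma epigraph_constraints_iff:
  fixes e :: "nat \<Rightarrow> 'n::finite"
  assumes N: "valid_icnn CARD('n) N"
  shows "(\<exists>z. (\<forall>k\<le>depth N. z k \<in> carrier_vec (width N k)) \<and>
      y = vec_index (z (depth N)) 0 \<and> coords e x = z 0 \<and>
      (\<forall>k<depth N. affine_layer N k (z 0) (z k) \<le> z (k + 1)) \<and>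
      (\<forall>k. 1 \<le> k \<and> k < depth N \<longrightarrow> 0\<^sub>v (width N k) \<le> z k))
    \<longleftrightarrow> icnn_fun e N x \<le> y" (is "(\<exists>z. ?E z) \<longleftrightarrow> _")
proof
  define m where "m = depth N - 1"
  have m: "m < depth N" "depth N = Suc m" "width N (Suc m) = 1"
    using N by (auto simp: m_def valid_icnn_def)
  have f: "icnn_fun e N x = vec_index (affine_layer N m (coords e x) (hidden_layer N (coords e x) m)) 0"
    by (simp add: icnn_fun_def Let_def m_def)
  {
    assume "\<exists>z. ?E z"
    then obtain z where z: "?E z" ..
    have z0: "z 0 \<in> carrier_vec CARD('n)"
      using z by (metis coords_carrier)
    have "hidden_layer N (z 0) m \<le> z m"
      using z m by (intro hidden_layer_least[where z = z, OF N z0]) auto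
    then have "affine_layer N m (z 0) (hidden_layer N (z 0) m) \<le> affine_layer N m (z 0) (z m)"
      using m by (intro affine_layer_mono[OF N m(1) z0] hidden_layer_carrier[OF N z0]) auto
    also have "\<dots> \<le> z (Suc m)"
      using z m by auto
    finally show "icnn_fun e N x \<le> y"
      using z m unfolding f by (auto simp: less_eq_vec_def)
  next
    assume y: "icnn_fun e N x \<le> y"
    \<comment> \<open>Forward-pass values except at the output: there \<open>hidden_layer\<close>
      would still apply the rectifier, so its value is replaced by \<open>y\<close>.\<close>
    define z where "z k = (if k = depth N then Matrix.vec 1 (\<lambda>_. y) else hidden_layer N (coords e x) k)" for k
    have c: "z k \<in> carrier_vec (width N k)" if "k \<le> depth N" for k
      using hidden_layer_carrier[OF N coords_carrier that] m by (auto simp: z_def)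
    have z0: "z 0 = coords e x"
      using m by (simp add: z_def)
    note d = dim_affine_layer[OF N]
    have "affine_layer N k (z 0) (z k) \<le> z (k + 1)" if k: "k < depth N" for k
    proof (cases "k = m")
      case True
      then show ?thesis
        using y m d[OF k] unfolding z0 f by (auto simp: z_def less_eq_vec_def)
    next
      case False
      then show ?thesis
        using k m d[OF k] unfolding z0 by (auto simp: z_def less_eq_vec_def relu_def)
    qed
    moreover have "0\<^sub>v (width N k) \<le> z k" if "1 \<le> k" "k < depth N" for k
    proof -
      obtain j where "k = Suc j"
        using \<open>1 \<le> k\<close> by (cases k) auto
      then show ?thesis
        using that m d[of j] by (auto simp: z_def less_eq_vec_def relu_def)
    qed
    ultimately have "?E z"
      using c m z0 by (auto simp: z_def)
    then show "\<exists>z. ?E z"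
      by (rule exI[of _ z])
  }
qed

section \<open>The projected region and comparison of relaxations\<close>

lemma projected_region_eq:
  fixes e :: "nat \<Rightarrow> 'n::finite"
  assumes N: "valid_icnn CARD('n) N"
  shows "projected_region e N l u =
    {(x, y). x \<in> cbox l u \<and> icnn_fun e N x \<le> y \<and> y \<le> concave_envelope (cbox l u) (icnn_fun e N) x}"
proof -
  have "(\<exists>z \<alpha>. epigraph_envelope_constraints e N l u x y z \<alpha>) \<longleftrightarrow>
      icnn_fun e N x \<le> y \<and> y \<le> concave_envelope (cbox l u) (icnn_fun e N) x"
    if x: "x \<in> cbox l u" for x y
  proof -
    have hull: "cbox l u = convex hull (range (vertex l u))"
      using convex_hull_vertex_eq_cbox x by blast
    have f: "convex_on (cbox l u) (icnn_fun e N)"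
      using convex_on_subset[OF convex_on_icnn_fun[OF N]] by simp
    show ?thesis
      \<comment> \<open>Once \<open>x\<close> and \<open>y\<close> are fixed, the conditions on
        \<open>z\<close> and on \<open>\<alpha>\<close> separate, so the joint existential splits
        into the two characterizations.\<close>
      unfolding le_concave_envelope_iff[OF f hull x] epigraph_constraints_iff[OF N, symmetric]
        epigraph_envelope_constraints_def
      by blast
  qed
  then show ?thesis
    unfolding projected_region_def by blast
qed

lemma projected_region_eq_convex_hull:
  fixes e :: "nat \<Rightarrow> 'n::finite"
  assumes N: "valid_icnn CARD('n) N"
  shows "projected_region e N l u = convex hull (graph_over (cbox l u) (icnn_fun e N))"
proof (cases "cbox l u = {}")
  \<comment> \<open>The vertices of an empty box still exist and span a nonempty hull, so this case
    is separate; here both sides are empty.\<close>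
  case True
  then show ?thesis
    by (simp add: projected_region_def graph_over_def)
next
  case False
  show ?thesis
    unfolding projected_region_eq[OF N]
    using convex_on_subset[OF convex_on_icnn_fun[OF N]] convex_hull_vertex_eq_cbox[OF False]
    by (intro convex_hull_graph_over_polytope[symmetric]) auto
qed

lemma image_feasible_R:
  "(\<lambda>(x, y, z, \<alpha>). (x, y)) ` feasible_R g e N l u = feasible_relaxed g (cbox l u) (projected_region e N l u)"
  by (force simp: feasible_R_def feasible_relaxed_def projected_region_def image_iff)

text \<open>The objective is constant along \<open>z\<close> and \<open>\<alpha>\<close>, so
  projecting them out leaves the infimum unchanged.\<close>

lemma opt_value_feasible_R:
  "opt_value (\<lambda>(x, y, z, \<alpha>). h (x, y)) (feasible_R g e N l u) =
    opt_value h (feasible_relaxed g (cbox l u) (projected_region e N l u))"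
  unfolding image_feasible_R[symmetric] opt_value_def image_image by (simp add: case_prod_unfold)

lemma opt_value_antimono: "A \<subseteq> B \<Longrightarrow> opt_value h B \<le> opt_value h A"
  unfolding opt_value_def by (rule INF_superset_mono) simp_all

theorem theorem1:
  fixes e :: "nat \<Rightarrow> 'n::finite"
    and N :: icnn
    and l u :: "real ^ 'n"
    and h :: "(real ^ 'n) \<times> real \<Rightarrow> real"
    and g :: "(real ^ 'n) \<times> real \<Rightarrow> real ^ 'm"
  assumes "bij_betw e {..<CARD('n)} UNIV"
    and "valid_icnn CARD('n) N"
  shows
    "projected_region e N l u =
       {(x, y). x \<in> cbox l u \<and> icnn_fun e N x \<le> y
              \<and> y \<le> concave_envelope (cbox l u) (icnn_fun e N) x}
     \<and> projected_region e N l u = convex hull (graph_over (cbox l u) (icnn_fun e N))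
     \<and> continuous_relaxation (graph_over (cbox l u) (icnn_fun e N)) (projected_region e N l u)
     \<and> (\<lambda>(x, y, z, \<alpha>). (x, y)) ` feasible_R g e N l u
         = feasible_relaxed g (cbox l u) (projected_region e N l u)
     \<and> feasible_P g e N l u \<subseteq> (\<lambda>(x, y, z, \<alpha>). (x, y)) ` feasible_R g e N l u
     \<and> opt_value (\<lambda>(x, y, z, \<alpha>). h (x, y)) (feasible_R g e N l u)
         \<le> opt_value h (feasible_P g e N l u)
     \<and> (\<forall>C. continuous_relaxation (graph_over (cbox l u) (icnn_fun e N)) C \<longrightarrow>
           (\<lambda>(x, y, z, \<alpha>). (x, y)) ` feasible_R g e N l u \<subseteq> feasible_relaxed g (cbox l u) C
         \<and> opt_value h (feasible_relaxed g (cbox l u) C)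
             \<le> opt_value (\<lambda>(x, y, z, \<alpha>). h (x, y)) (feasible_R g e N l u))"
proof -
  let ?G = "graph_over (cbox l u) (icnn_fun e N)" and ?R = "projected_region e N l u"
  note N = assms(2)
  have hull: "?R = convex hull ?G"
    by (rule projected_region_eq_convex_hull[OF N])
  then have GR: "?G \<subseteq> ?R" and cR: "convex ?R"
    by (auto simp: hull_subset)
  have P: "feasible_P g e N l u \<subseteq> feasible_relaxed g (cbox l u) ?R"
    using GR by (auto simp: feasible_P_def feasible_relaxed_def graph_over_def)
  \<comment> \<open>The hull is the least convex set containing the graph, and the constraints on
    \<open>g\<close> and the box are the same on both sides.\<close>
  have C: "feasible_relaxed g (cbox l u) ?R \<subseteq> feasible_relaxed g (cbox l u) C"
    if "continuous_relaxation ?G C" for C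
  proof -
    have "?R \<subseteq> C"
      using that unfolding hull continuous_relaxation_def by (simp add: hull_minimal)
    then show ?thesis
      by (auto simp: feasible_relaxed_def)
  qed
  show ?thesis
    unfolding image_feasible_R opt_value_feasible_R
    using projected_region_eq[OF N, of e l u] hull GR cR P C opt_value_antimono[OF P]
      opt_value_antimono[OF C]
    unfolding continuous_relaxation_def by blast
qed

end
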